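(* Let $X$ be a Tychonoff space and let $\mathscr{P}$ be an ideal of closed sets in $X$. Then $\Gamma(C_\mathscr{P}(X))=AG(C_\mathscr{P}(X))=W\Gamma(C_\mathscr{P}(X))$ if and only if $|X_\mathscr{P}|\leq 2$.
   Context: $C(X)$ is the ring of all real valued continuous functions on the Tychonoff (completely regular Hausdorff) space $X$; $Z(f)=\{x\in X: f(x)=0\}$. An ideal of closed sets in $X$ is a nonempty family $\mathscr{P}$ of closed subsets of $X$ such that $A,B\in\mathscr{P}$ implies $A\cup B\in\mathscr{P}$, and $A\in\mathscr{P}$, $C\subset A$ with $C$ closed in $X$ implies $C\in\mathscr{P}$. $C_\mathscr{P}(X)=\{f\in C(X): cl_X(X\setminus Z(f))\in\mathscr{P}\}$, a commutative ring (possibly without identity). $X_\mathscr{P}$ is the set of all $x\in X$ having an open neighborhood $V$ with $cl_XV\in\mathscr{P}$. For a commutative ring $R$, $Z(R)^*$ is the set of nonzero zero divisors, i.e. nonzero $a\in R$ with $ab=0$ for some nonzero $b\in R$, and $ann(a)=\{r\in R: ra=0\}$. The following are simple graphs with vertex set $Z(R)^*$ (possibly empty graphs). Zero divisor graph $\Gamma(R)$: distinct $a,b$ are adjacent iff $ab=0$. Annihilator graph $AG(R)$: distinct $a,b$ are adjacent iff $ann(a)\cup ann(b)\neq ann(ab)$. Weakly zero divisor graph $W\Gamma(R)$: distinct $a,b$ are adjacent iff there exist $c\in ann(a)\setminus\{0\}$ and $d\in ann(b)\setminus\{0\}$ with $cd=0$. *)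

theory Defs
  imports "HOL-Analysis.Analysis" "HOL-Algebra.Ideal" "Graph_Theory.Pair_Digraph"
begin

section \<open>Ideals of closed sets\<close>

definition ideal_of_closed_sets :: "'a topology \<Rightarrow> 'a set set \<Rightarrow> bool" where
  "ideal_of_closed_sets X P \<longleftrightarrow>
     P \<noteq> {} \<and> (\<forall>A\<in>P. closedin X A) \<and>
     (\<forall>A\<in>P. \<forall>B\<in>P. A \<union> B \<in> P) \<and>
     (\<forall>A\<in>P. \<forall>C. closedin X C \<and> C \<subseteq> A \<longrightarrow> C \<in> P)"

definition local_points :: "'a topology \<Rightarrow> 'a set set \<Rightarrow> 'a set" where
  "local_points X P =
     {x \<in> topspace X. \<exists>V. openin X V \<and> x \<in> V \<and> X closure_of V \<in> P}"


section \<open>The rings \<open>C(X)\<close> and \<open>C\<^sub>P(X)\<close>\<close>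

text \<open>
  A function on \<open>X\<close> is represented by its extensional representative, which is
  \<^term>\<open>undefined\<close> off \<^term>\<open>topspace X\<close>, so that equality of ring elements is
  equality of functions on the space.
\<close>

definition continuous_function_ring :: "'a topology \<Rightarrow> ('a \<Rightarrow> real) ring" where
  "continuous_function_ring X =
     \<lparr>carrier = {f \<in> extensional (topspace X). continuous_map X euclideanreal f},
      mult = (\<lambda>f g. \<lambda>x\<in>topspace X. f x * g x),
      one = (\<lambda>x\<in>topspace X. 1),
      zero = (\<lambda>x\<in>topspace X. 0),
      add = (\<lambda>f g. \<lambda>x\<in>topspace X. f x + g x)\<rparr>"

definition zero_set :: "'a topology \<Rightarrow> ('a \<Rightarrow> real) \<Rightarrow> 'a set" where
  "zero_set X f = {x \<in> topspace X. f x = 0}"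

text \<open>
  \<open>C\<^sub>P(X)\<close> inherits its operations from \<open>C(X)\<close>. It need not have an identity: the
  \<^const>\<open>one\<close> field of the record is the identity of \<open>C(X)\<close>, which may lie outside the
  carrier, and nothing below refers to it.
\<close>

definition ideal_function_ring :: "'a topology \<Rightarrow> 'a set set \<Rightarrow> ('a \<Rightarrow> real) ring" where
  "ideal_function_ring X P =
     (continuous_function_ring X)
       \<lparr>carrier := {f \<in> carrier (continuous_function_ring X).
                      X closure_of (topspace X - zero_set X f) \<in> P}\<rparr>"


section \<open>Zero divisors and graphs of a commutative ring\<close>

text \<open>These notions only use the carrier, the zero and the multiplication of the ring.\<close>

definition nonzero_zero_divisors :: "('a, 'm) ring_scheme \<Rightarrow> 'a set" where
  "nonzero_zero_divisors R =
     {a \<in> carrier R. a \<noteq> \<zero>\<^bsub>R\<^esub> \<and> (\<exists>b\<in>carrier R. b \<noteq> \<zero>\<^bsub>R\<^esub> \<and> a \<otimes>\<^bsub>R\<^esub> b = \<zero>\<^bsub>R\<^esub>)}"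

definition ann :: "('a, 'm) ring_scheme \<Rightarrow> 'a \<Rightarrow> 'a set" where
  "ann R a = {r \<in> carrier R. r \<otimes>\<^bsub>R\<^esub> a = \<zero>\<^bsub>R\<^esub>}"

text \<open>
  A simple graph is a symmetric digraph without loops or parallel arcs
  (\<^locale>\<open>pair_bidirected_digraph\<close>); \<^const>\<open>parcs\<close> is its adjacency relation. The vertex
  set may be empty or infinite.
\<close>

definition zero_divisor_graph :: "('a, 'm) ring_scheme \<Rightarrow> 'a pair_pre_digraph" where
  "zero_divisor_graph R =
     \<lparr>pverts = nonzero_zero_divisors R,
      parcs = {(a, b). a \<in> nonzero_zero_divisors R \<and> b \<in> nonzero_zero_divisors R \<and> a \<noteq> b \<and>
                 a \<otimes>\<^bsub>R\<^esub> b = \<zero>\<^bsub>R\<^esub>}\<rparr>"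

definition annihilator_graph :: "('a, 'm) ring_scheme \<Rightarrow> 'a pair_pre_digraph" where
  "annihilator_graph R =
     \<lparr>pverts = nonzero_zero_divisors R,
      parcs = {(a, b). a \<in> nonzero_zero_divisors R \<and> b \<in> nonzero_zero_divisors R \<and> a \<noteq> b \<and>
                 ann R a \<union> ann R b \<noteq> ann R (a \<otimes>\<^bsub>R\<^esub> b)}\<rparr>"

definition weakly_zero_divisor_graph :: "('a, 'm) ring_scheme \<Rightarrow> 'a pair_pre_digraph" where
  "weakly_zero_divisor_graph R =
     \<lparr>pverts = nonzero_zero_divisors R,
      parcs = {(a, b). a \<in> nonzero_zero_divisors R \<and> b \<in> nonzero_zero_divisors R \<and> a \<noteq> b \<and>
                 (\<exists>c \<in> ann R a - {\<zero>\<^bsub>R\<^esub>}. \<exists>d \<in> ann R b - {\<zero>\<^bsub>R\<^esub>}. c \<otimes>\<^bsub>R\<^esub> d = \<zero>\<^bsub>R\<^esub>)}\<rparr>"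


section \<open>Well-definedness\<close>

lemma cring_continuous_function_ring: "cring (continuous_function_ring X)"
proof -
  let ?R = "continuous_function_ring X"
  have restr: "continuous_map X euclideanreal (restrict f (topspace X)) \<longleftrightarrow>
      continuous_map X euclideanreal f" for f
    by (rule iffI; erule continuous_map_eq) auto
  note simps = continuous_function_ring_def restr restrict_extensional
    continuous_map_add continuous_map_real_mult continuous_map_minus
  show ?thesis
  proof (rule cringI)
    show "abelian_group ?R"
    proof (rule abelian_groupI)
      fix f assume f: "f \<in> carrier ?R"
      show "\<exists>g\<in>carrier ?R. g \<oplus>\<^bsub>?R\<^esub> f = \<zero>\<^bsub>?R\<^esub>"
        using f by (intro bexI[of _ "\<lambda>x\<in>topspace X. - f x"]) (auto simp: simps cong: restrict_cong)
      show "\<zero>\<^bsub>?R\<^esub> \<oplus>\<^bsub>?R\<^esub> f = f"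
        using f by (auto simp: simps extensional_def fun_eq_iff)
    qed (auto simp: simps fun_eq_iff)
    show "comm_monoid ?R"
    proof (rule comm_monoidI)
      fix f assume f: "f \<in> carrier ?R"
      show "\<one>\<^bsub>?R\<^esub> \<otimes>\<^bsub>?R\<^esub> f = f"
        using f by (auto simp: simps extensional_def fun_eq_iff)
    qed (auto simp: simps fun_eq_iff)
  qed (auto simp: simps fun_eq_iff algebra_simps)
qed

lemma ideal_ideal_function_ring:
  assumes P: "ideal_of_closed_sets X P"
  shows "ideal (carrier (ideal_function_ring X P)) (continuous_function_ring X)"
proof -
  let ?R = "continuous_function_ring X"
  interpret R: cring ?R by (rule cring_continuous_function_ring)
  let ?N = "\<lambda>f. topspace X - zero_set X f"
  have un: "A \<in> P \<Longrightarrow> B \<in> P \<Longrightarrow> A \<union> B \<in> P"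
    and sub: "A \<in> P \<Longrightarrow> closedin X C \<Longrightarrow> C \<subseteq> A \<Longrightarrow> C \<in> P" for A B C
    using P unfolding ideal_of_closed_sets_def by blast+
  have mono: "X closure_of S \<in> P" if "X closure_of T \<in> P" "S \<subseteq> T" for S T
    by (rule sub[OF that(1) closedin_closure_of closure_of_mono[OF that(2)]])
  obtain A where "A \<in> P" using P unfolding ideal_of_closed_sets_def by blast
  then have empty: "{} \<in> P" by (rule sub) simp_all
  have mem: "f \<in> carrier (ideal_function_ring X P) \<longleftrightarrow>
      f \<in> carrier ?R \<and> X closure_of ?N f \<in> P" for f
    by (simp add: ideal_function_ring_def)
  have neg: "(\<ominus>\<^bsub>?R\<^esub> f) x = - f x" if "f \<in> carrier ?R" "x \<in> topspace X" for f x
  proof -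
    have "(f \<oplus>\<^bsub>?R\<^esub> (\<ominus>\<^bsub>?R\<^esub> f)) x = \<zero>\<^bsub>?R\<^esub> x"
      using that R.r_neg by simp
    then show ?thesis
      using that(2) by (simp add: continuous_function_ring_def)
  qed
  show ?thesis
  proof (rule idealI[OF R.ring_axioms])
    show "subgroup (carrier (ideal_function_ring X P)) (add_monoid ?R)"
    proof (rule R.add.subgroupI)
      show "carrier (ideal_function_ring X P) \<subseteq> carrier ?R"
        by (auto simp: mem)
      have "?N \<zero>\<^bsub>?R\<^esub> = {}"
        by (auto simp: zero_set_def continuous_function_ring_def)
      then have "\<zero>\<^bsub>?R\<^esub> \<in> carrier (ideal_function_ring X P)"
        unfolding mem using empty by (simp only:) simp
      then show "carrier (ideal_function_ring X P) \<noteq> {}"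
        by blast
    next
      fix f assume f: "f \<in> carrier (ideal_function_ring X P)"
      then have "?N (\<ominus>\<^bsub>?R\<^esub> f) = ?N f"
        by (auto simp: zero_set_def neg mem)
      then show "\<ominus>\<^bsub>?R\<^esub> f \<in> carrier (ideal_function_ring X P)"
        using f R.a_inv_closed by (simp add: mem)
    next
      fix f g assume fg: "f \<in> carrier (ideal_function_ring X P)" "g \<in> carrier (ideal_function_ring X P)"
      have "X closure_of (?N f \<union> ?N g) \<in> P"
        using fg un by (simp add: mem closure_of_Un)
      moreover have "?N (f \<oplus>\<^bsub>?R\<^esub> g) \<subseteq> ?N f \<union> ?N g"
        by (auto simp: zero_set_def continuous_function_ring_def)
      ultimately have "X closure_of ?N (f \<oplus>\<^bsub>?R\<^esub> g) \<in> P"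
        by (rule mono)
      then show "f \<oplus>\<^bsub>?R\<^esub> g \<in> carrier (ideal_function_ring X P)"
        using fg by (simp add: mem)
    qed
    fix f g assume fg: "f \<in> carrier (ideal_function_ring X P)" "g \<in> carrier ?R"
    have "?N (g \<otimes>\<^bsub>?R\<^esub> f) \<subseteq> ?N f"
      by (auto simp: zero_set_def continuous_function_ring_def)
    then show "g \<otimes>\<^bsub>?R\<^esub> f \<in> carrier (ideal_function_ring X P)"
      using fg by (auto simp: mem intro: mono)
    then show "f \<otimes>\<^bsub>?R\<^esub> g \<in> carrier (ideal_function_ring X P)"
      using fg by (simp add: mem R.m_comm)
  qed
qed

lemma
  fixes X :: "'a topology" and P
  defines "R \<equiv> ideal_function_ring X P"
  shows simple_zero_divisor_graph: "pair_bidirected_digraph (zero_divisor_graph R)"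
    and simple_annihilator_graph: "pair_bidirected_digraph (annihilator_graph R)"
    and simple_weakly_zero_divisor_graph: "pair_bidirected_digraph (weakly_zero_divisor_graph R)"
proof -
  have comm: "f \<otimes>\<^bsub>R\<^esub> g = g \<otimes>\<^bsub>R\<^esub> f" for f g
    by (auto simp: R_def ideal_function_ring_def continuous_function_ring_def mult.commute)
  have *: "pair_bidirected_digraph \<lparr>pverts = V, parcs = {(a, b). a \<in> V \<and> b \<in> V \<and> a \<noteq> b \<and> adj a b}\<rparr>"
    if "\<And>a b. adj a b \<Longrightarrow> adj b a" for V :: "('a \<Rightarrow> real) set" and adj
    using that by unfold_locales (auto simp: symmetric_def sym_def)
  show "pair_bidirected_digraph (zero_divisor_graph R)"
    unfolding zero_divisor_graph_def by (rule *) (subst comm)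
  show "pair_bidirected_digraph (annihilator_graph R)"
    unfolding annihilator_graph_def by (rule *) (simp add: comm Un_commute)
  show "pair_bidirected_digraph (weakly_zero_divisor_graph R)"
    unfolding weakly_zero_divisor_graph_def
  proof (rule *, elim bexE)
    fix a b c d
    assume "c \<in> ann R a - {\<zero>\<^bsub>R\<^esub>}" "d \<in> ann R b - {\<zero>\<^bsub>R\<^esub>}" "c \<otimes>\<^bsub>R\<^esub> d = \<zero>\<^bsub>R\<^esub>"
    then show "\<exists>c\<in>ann R b - {\<zero>\<^bsub>R\<^esub>}. \<exists>d\<in>ann R a - {\<zero>\<^bsub>R\<^esub>}. c \<otimes>\<^bsub>R\<^esub> d = \<zero>\<^bsub>R\<^esub>"
      using comm[of c d] by (intro bexI[of _ d] bexI[of _ c]) simp_all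
  qed
qed

end

theory Submission
  imports Defs
begin

text \<open>
  A function in \<open>C\<^sub>P(X)\<close> vanishes off the open set \<open>X\<^sub>P\<close>, and complete regularity provides, for each
  point of \<open>X\<^sub>P\<close> and each neighbourhood of it, a member of \<open>C\<^sub>P(X)\<close> that lives in this neighbourhood
  and does not vanish at the point. Multiplication is pointwise, so what matters about a function
  is on which points of \<open>X\<^sub>P\<close> it is nonzero.

  Since \<open>C\<^sub>P(X)\<close> is reduced, \<open>a b = 0\<close> always gives an edge in the other two graphs: \<open>b\<close> and \<open>a\<close>
  themselves witness the weak relation, and \<open>a + b\<close> annihilates \<open>a b\<close> but neither \<open>a\<close> nor \<open>b\<close>.
  Hence the three graphs agree iff \<open>a b \<noteq> 0\<close> excludes both other kinds of edges.

  Suppose that \<open>X\<^sub>P\<close> has at most two points and that the vertices \<open>a\<close>, \<open>b\<close> are both nonzero at \<open>p\<close>.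
  Being zero divisors, they both vanish at the only other point \<open>q\<close>
  (\<open>common_support_of_zero_divisors\<close>). So \<open>a\<close>, \<open>b\<close> and \<open>a b\<close> have the same support and the same
  annihilator, and nonzero annihilators of \<open>a\<close> and of \<open>b\<close> are all nonzero at \<open>q\<close>, so that they
  never multiply to zero.

  If \<open>X\<^sub>P\<close> has three points, there are nonzero \<open>f\<close>, \<open>g\<close>, \<open>h\<close> with disjoint supports. Then \<open>f\<close> and
  \<open>f + f\<close> are joined in the weakly zero divisor graph, by way of \<open>g\<close> and \<open>h\<close>, but their product is
  not zero.
\<close>

section \<open>Pointwise description of the ring\<close>

lemma ideal_function_ring_mult:
  "f \<otimes>\<^bsub>ideal_function_ring X P\<^esub> g = (\<lambda>x\<in>topspace X. f x * g x)"
  by (simp add: ideal_function_ring_def continuous_function_ring_def)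

lemma ideal_function_ring_add:
  "f \<oplus>\<^bsub>ideal_function_ring X P\<^esub> g = (\<lambda>x\<in>topspace X. f x + g x)"
  by (simp add: ideal_function_ring_def continuous_function_ring_def)

lemma ideal_function_ring_zero:
  "\<zero>\<^bsub>ideal_function_ring X P\<^esub> = (\<lambda>x\<in>topspace X. 0)"
  by (simp add: ideal_function_ring_def continuous_function_ring_def)

lemma ideal_function_ring_mem_iff:
  "f \<in> carrier (ideal_function_ring X P) \<longleftrightarrow>
     f \<in> extensional (topspace X) \<and> continuous_map X euclideanreal f \<and>
     X closure_of {x \<in> topspace X. f x \<noteq> 0} \<in> P"
proof -
  have "topspace X - zero_set X f = {x \<in> topspace X. f x \<noteq> 0}"
    by (auto simp: zero_set_def)
  then show ?thesis
    by (simp add: ideal_function_ring_def continuous_function_ring_def)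
qed

lemma eq_ideal_function_ring_zero_iff:
  assumes "f \<in> carrier (ideal_function_ring X P)"
  shows "f = \<zero>\<^bsub>ideal_function_ring X P\<^esub> \<longleftrightarrow> (\<forall>x\<in>topspace X. f x = 0)"
  using assms
  by (auto simp: ideal_function_ring_zero ideal_function_ring_mem_iff extensional_def fun_eq_iff)

lemma mult_eq_ideal_function_ring_zero_iff:
  "f \<otimes>\<^bsub>ideal_function_ring X P\<^esub> g = \<zero>\<^bsub>ideal_function_ring X P\<^esub> \<longleftrightarrow>
     (\<forall>x\<in>topspace X. f x = 0 \<or> g x = 0)"
  by (auto simp: ideal_function_ring_zero ideal_function_ring_mult fun_eq_iff restrict_def)

lemma ideal_function_ring_add_closed:
  assumes "ideal_of_closed_sets X P"
    and "f \<in> carrier (ideal_function_ring X P)" "g \<in> carrier (ideal_function_ring X P)"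
  shows "f \<oplus>\<^bsub>ideal_function_ring X P\<^esub> g \<in> carrier (ideal_function_ring X P)"
  using additive_subgroup.a_closed[OF ideal.axioms(1)[OF ideal_ideal_function_ring[OF assms(1)]] assms(2,3)]
  by (simp add: ideal_function_ring_def)

lemma mem_ann_ideal_function_ring_iff:
  "r \<in> ann (ideal_function_ring X P) f \<longleftrightarrow>
     r \<in> carrier (ideal_function_ring X P) \<and> (\<forall>x\<in>topspace X. r x = 0 \<or> f x = 0)"
  by (simp add: ann_def mult_eq_ideal_function_ring_zero_iff)

lemma nonzero_zero_divisor_ideal_function_ring_iff:
  "f \<in> nonzero_zero_divisors (ideal_function_ring X P) \<longleftrightarrow>
     f \<in> carrier (ideal_function_ring X P) \<and> (\<exists>x\<in>topspace X. f x \<noteq> 0) \<and>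
     (\<exists>g\<in>carrier (ideal_function_ring X P).
        (\<exists>x\<in>topspace X. g x \<noteq> 0) \<and> (\<forall>x\<in>topspace X. f x = 0 \<or> g x = 0))"
  unfolding nonzero_zero_divisors_def
  by (auto simp: eq_ideal_function_ring_zero_iff mult_eq_ideal_function_ring_zero_iff)
    (auto simp: ideal_function_ring_zero)

section \<open>Supports and local points\<close>

text \<open>The set where \<open>f\<close> is nonzero is itself the required open neighbourhood.\<close>

lemma nonzero_imp_local_point:
  assumes "f \<in> carrier (ideal_function_ring X P)" "x \<in> topspace X" "f x \<noteq> 0"
  shows "x \<in> local_points X P"
proof -
  have "openin X {x \<in> topspace X. f x \<in> - {0}}"
    using assms(1) by (intro openin_continuous_map_preimage[where Y = euclideanreal])
      (auto simp: ideal_function_ring_mem_iff)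
  then show ?thesis
    using assms by (auto simp: local_points_def ideal_function_ring_mem_iff)
qed

text \<open>
  The support of a function given by complete regularity is made small twice: inside \<open>U\<close>, as
  wanted, and inside a neighbourhood with closure in \<open>P\<close>, for membership in the ring.
\<close>

lemma ideal_function_ring_bump:
  assumes "completely_regular_space X" and P: "ideal_of_closed_sets X P"
    and x: "x \<in> local_points X P" and U: "openin X U" "x \<in> U"
  obtains f where "f \<in> carrier (ideal_function_ring X P)" "f x \<noteq> 0"
    "\<And>y. y \<in> topspace X - U \<Longrightarrow> f y = 0"
proof -
  obtain V where V: "openin X V" "x \<in> V" "X closure_of V \<in> P"
    using x by (auto simp: local_points_def)
  have "closedin X (topspace X - U \<inter> V)" "x \<in> topspace X - (topspace X - U \<inter> V)"
    using U V openin_subset[OF V(1)] by auto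
  then obtain f where f: "continuous_map X euclideanreal f" "f x = 0"
      and f1: "f ` (topspace X - U \<inter> V) \<subseteq> {1}"
    using assms(1) unfolding completely_regular_space_def continuous_map_in_subtopology by metis
  \<comment> \<open>The standard formulation of complete regularity separates with the values 0 and 1 the other
    way round.\<close>
  define g where "g = (\<lambda>y\<in>topspace X. 1 - f y)"
  have off: "g y = 0" if "y \<in> topspace X - U \<inter> V" for y
    using that f1 by (auto simp: g_def)
  have "X closure_of {y \<in> topspace X. g y \<noteq> 0} \<subseteq> X closure_of V"
    using off by (intro closure_of_mono) auto
  then have "X closure_of {y \<in> topspace X. g y \<noteq> 0} \<in> P"
    using P V(3) unfolding ideal_of_closed_sets_def by (meson closedin_closure_of)
  moreover have "continuous_map X euclideanreal g"
    by (rule continuous_map_eq[where f = "\<lambda>y. 1 - f y"])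
      (auto simp: g_def intro!: continuous_map_diff f(1))
  moreover have "g \<in> extensional (topspace X)"
    by (simp add: g_def)
  ultimately have "g \<in> carrier (ideal_function_ring X P)"
    by (simp add: ideal_function_ring_mem_iff)
  moreover have "g x \<noteq> 0"
    using x f(2) by (simp add: g_def local_points_def)
  ultimately show thesis
    using off that by blast
qed

lemma Hausdorff_space_separate_three:
  assumes "Hausdorff_space X" "{x, y, z} \<subseteq> topspace X" "x \<noteq> y" "x \<noteq> z" "y \<noteq> z"
  obtains U V W where "openin X U" "openin X V" "openin X W" "x \<in> U" "y \<in> V" "z \<in> W"
    "U \<inter> V = {}" "U \<inter> W = {}" "V \<inter> W = {}"
proof -
  have sep: "\<exists>U V. openin X U \<and> openin X V \<and> u \<in> U \<and> v \<in> V \<and> disjnt U V"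
    if "u \<in> topspace X" "v \<in> topspace X" "u \<noteq> v" for u v
    using assms(1) that unfolding Hausdorff_space_def by blast
  obtain A B where AB: "openin X A" "openin X B" "x \<in> A" "y \<in> B" "disjnt A B"
    using sep[of x y] assms by auto
  obtain C D where CD: "openin X C" "openin X D" "x \<in> C" "z \<in> D" "disjnt C D"
    using sep[of x z] assms by auto
  obtain E F where EF: "openin X E" "openin X F" "y \<in> E" "z \<in> F" "disjnt E F"
    using sep[of y z] assms by auto
  show thesis
    by (rule that[of "A \<inter> C" "B \<inter> E" "D \<inter> F"]) (use AB CD EF in \<open>auto simp: disjnt_def\<close>)
qed

section \<open>Comparison of the graphs\<close>

lemma zero_divisor_graph_subset_weakly_zero_divisor_graph:
  "parcs (zero_divisor_graph (ideal_function_ring X P)) \<subseteq>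
     parcs (weakly_zero_divisor_graph (ideal_function_ring X P))"
proof
  let ?R = "ideal_function_ring X P"
  fix e assume "e \<in> parcs (zero_divisor_graph ?R)"
  then obtain a b where e: "e = (a, b)" "a \<noteq> b" "a \<in> nonzero_zero_divisors ?R"
      "b \<in> nonzero_zero_divisors ?R" and ab: "a \<otimes>\<^bsub>?R\<^esub> b = \<zero>\<^bsub>?R\<^esub>"
    by (auto simp: zero_divisor_graph_def)
  moreover have ba: "b \<otimes>\<^bsub>?R\<^esub> a = \<zero>\<^bsub>?R\<^esub>"
    using ab by (auto simp: mult_eq_ideal_function_ring_zero_iff)
  moreover have "b \<in> ann ?R a - {\<zero>\<^bsub>?R\<^esub>}" "a \<in> ann ?R b - {\<zero>\<^bsub>?R\<^esub>}"
    using e ab ba by (auto simp: ann_def nonzero_zero_divisors_def)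
  ultimately show "e \<in> parcs (weakly_zero_divisor_graph ?R)"
    unfolding weakly_zero_divisor_graph_def by auto
qed

text \<open>
  The sum \<open>a + b\<close> annihilates \<open>a b = 0\<close>. It agrees with \<open>a\<close> where \<open>a\<close> is nonzero, so its product
  with \<open>a\<close> is \<open>a\<^sup>2 \<noteq> 0\<close>, and likewise for \<open>b\<close>.
\<close>

lemma zero_divisor_graph_subset_annihilator_graph:
  assumes P: "ideal_of_closed_sets X P"
  shows "parcs (zero_divisor_graph (ideal_function_ring X P)) \<subseteq>
           parcs (annihilator_graph (ideal_function_ring X P))"
proof
  let ?R = "ideal_function_ring X P"
  fix e assume "e \<in> parcs (zero_divisor_graph ?R)"
  then obtain a b where e: "e = (a, b)" "a \<noteq> b" and V: "a \<in> nonzero_zero_divisors ?R"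
      "b \<in> nonzero_zero_divisors ?R" and ab: "\<forall>x\<in>topspace X. a x = 0 \<or> b x = 0"
    by (auto simp: zero_divisor_graph_def mult_eq_ideal_function_ring_zero_iff)
  obtain x y where xy: "x \<in> topspace X" "y \<in> topspace X" "a x \<noteq> 0" "b y \<noteq> 0"
      and carr: "a \<in> carrier ?R" "b \<in> carrier ?R"
    using V by (auto simp: nonzero_zero_divisor_ideal_function_ring_iff)
  define s where "s = a \<oplus>\<^bsub>?R\<^esub> b"
  have s: "s \<in> carrier ?R"
    unfolding s_def using P carr by (rule ideal_function_ring_add_closed)
  moreover have "s x \<noteq> 0" "s y \<noteq> 0"
    using xy ab by (auto simp: s_def ideal_function_ring_add)
  ultimately have "s \<notin> ann ?R a \<union> ann ?R b"
    using xy by (auto simp: mem_ann_ideal_function_ring_iff)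
  moreover have "s \<in> ann ?R (a \<otimes>\<^bsub>?R\<^esub> b)"
    using s ab by (simp add: mem_ann_ideal_function_ring_iff ideal_function_ring_mult)
  ultimately show "e \<in> parcs (annihilator_graph ?R)"
    using e V unfolding annihilator_graph_def by auto
qed

lemma doubleton_if_card_le_2:
  assumes "finite S" "card S \<le> 2" "p \<in> S" "q \<in> S" "p \<noteq> q"
  shows "S = {p, q}"
  using assms card_seteq[of S "{p, q}"] by auto

text \<open>
  With at most two local points, a nonzero function annihilating \<open>a\<close> has to live at the one other
  than \<open>p\<close>. This forces a second local point \<open>q\<close> to exist, and \<open>a\<close> to vanish there; the same \<open>q\<close>
  serves \<open>b\<close>.
\<close>

lemma common_support_of_zero_divisors:
  fixes X :: "'a topology" and P :: "'a set set"
  defines "R \<equiv> ideal_function_ring X P"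
  assumes two: "finite (local_points X P)" "card (local_points X P) \<le> 2"
    and V: "a \<in> nonzero_zero_divisors R" "b \<in> nonzero_zero_divisors R"
    and ab: "a \<otimes>\<^bsub>R\<^esub> b \<noteq> \<zero>\<^bsub>R\<^esub>"
  obtains p q where "local_points X P = {p, q}" "p \<in> topspace X" "q \<in> topspace X"
    "a p \<noteq> 0" "b p \<noteq> 0" "a q = 0" "b q = 0"
proof -
  obtain p where p: "p \<in> topspace X" "a p \<noteq> 0" "b p \<noteq> 0"
    using ab by (auto simp: R_def mult_eq_ideal_function_ring_zero_iff)
  then have pL: "p \<in> local_points X P"
    using V(1) nonzero_imp_local_point
    by (auto simp: R_def nonzero_zero_divisor_ideal_function_ring_iff)
  have *: "\<exists>q\<in>local_points X P. q \<noteq> p \<and> f q = 0"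
    if f: "f \<in> nonzero_zero_divisors R" "f p \<noteq> 0" for f
  proof -
    obtain g q where "g \<in> carrier R" "q \<in> topspace X" "g q \<noteq> 0" "f q = 0"
      using f(1) by (auto simp: R_def nonzero_zero_divisor_ideal_function_ring_iff)
    then show ?thesis
      using f(2) nonzero_imp_local_point unfolding R_def by metis
  qed
  obtain q where q: "q \<in> local_points X P" "q \<noteq> p" "a q = 0"
    using *[OF V(1) p(2)] by blast
  obtain r where r: "r \<in> local_points X P" "r \<noteq> p" "b r = 0"
    using *[OF V(2) p(3)] by blast
  have L: "local_points X P = {p, q}"
    using doubleton_if_card_le_2[OF two pL q(1)] q(2) by simp
  then have "r = q"
    using r by auto
  then show thesis
    using that[OF L p(1) _ p(2,3) q(3)] q(1) r(3) by (simp add: local_points_def)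
qed

lemma annihilator_graph_subset_zero_divisor_graph:
  assumes two: "finite (local_points X P)" "card (local_points X P) \<le> 2"
  shows "parcs (annihilator_graph (ideal_function_ring X P)) \<subseteq>
           parcs (zero_divisor_graph (ideal_function_ring X P))"
proof
  let ?R = "ideal_function_ring X P"
  fix e assume "e \<in> parcs (annihilator_graph ?R)"
  then obtain a b where e: "e = (a, b)" "a \<noteq> b" and V: "a \<in> nonzero_zero_divisors ?R"
      "b \<in> nonzero_zero_divisors ?R" and ann: "ann ?R a \<union> ann ?R b \<noteq> ann ?R (a \<otimes>\<^bsub>?R\<^esub> b)"
    by (auto simp: annihilator_graph_def)
  have "a \<otimes>\<^bsub>?R\<^esub> b = \<zero>\<^bsub>?R\<^esub>"
  proof (rule ccontr)
    assume "a \<otimes>\<^bsub>?R\<^esub> b \<noteq> \<zero>\<^bsub>?R\<^esub>"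
    from common_support_of_zero_divisors[OF two V this]
    obtain p q where pq: "local_points X P = {p, q}" "a p \<noteq> 0" "b p \<noteq> 0" "a q = 0" "b q = 0" .
    have carr: "a \<in> carrier ?R" "b \<in> carrier ?R"
      using V by (auto simp: nonzero_zero_divisors_def)
    have supp: "a x = 0 \<longleftrightarrow> x \<noteq> p" "b x = 0 \<longleftrightarrow> x \<noteq> p" if "x \<in> topspace X" for x
      using pq that nonzero_imp_local_point[OF carr(1) that] nonzero_imp_local_point[OF carr(2) that]
      by auto
    then have "ann ?R a \<union> ann ?R b = ann ?R (a \<otimes>\<^bsub>?R\<^esub> b)"
      by (auto simp: mem_ann_ideal_function_ring_iff ideal_function_ring_mult)
    with ann show False
      by blast
  qed
  then show "e \<in> parcs (zero_divisor_graph ?R)"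
    using e V by (simp add: zero_divisor_graph_def)
qed

lemma weakly_zero_divisor_graph_subset_zero_divisor_graph:
  assumes two: "finite (local_points X P)" "card (local_points X P) \<le> 2"
  shows "parcs (weakly_zero_divisor_graph (ideal_function_ring X P)) \<subseteq>
           parcs (zero_divisor_graph (ideal_function_ring X P))"
proof
  let ?R = "ideal_function_ring X P"
  fix e assume "e \<in> parcs (weakly_zero_divisor_graph ?R)"
  then obtain a b c d where e: "e = (a, b)" "a \<noteq> b" and V: "a \<in> nonzero_zero_divisors ?R"
      "b \<in> nonzero_zero_divisors ?R"
      and cd: "c \<in> ann ?R a - {\<zero>\<^bsub>?R\<^esub>}" "d \<in> ann ?R b - {\<zero>\<^bsub>?R\<^esub>}" "c \<otimes>\<^bsub>?R\<^esub> d = \<zero>\<^bsub>?R\<^esub>"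
    by (auto simp: weakly_zero_divisor_graph_def)
  have "a \<otimes>\<^bsub>?R\<^esub> b = \<zero>\<^bsub>?R\<^esub>"
  proof (rule ccontr)
    assume "a \<otimes>\<^bsub>?R\<^esub> b \<noteq> \<zero>\<^bsub>?R\<^esub>"
    from common_support_of_zero_divisors[OF two V this]
    obtain p q where pq: "local_points X P = {p, q}" "p \<in> topspace X" "q \<in> topspace X"
      "a p \<noteq> 0" "b p \<noteq> 0" .
    have "g q \<noteq> 0" if g: "g \<in> ann ?R f - {\<zero>\<^bsub>?R\<^esub>}" and f: "f p \<noteq> 0" for f g
    proof -
      have "g \<in> carrier ?R" "g p = 0"
        using g f pq(2) by (auto simp: mem_ann_ideal_function_ring_iff)
      moreover obtain x where "x \<in> topspace X" "g x \<noteq> 0"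
        using g by (auto simp: mem_ann_ideal_function_ring_iff eq_ideal_function_ring_zero_iff)
      ultimately show ?thesis
        using nonzero_imp_local_point[of g X P x] pq(1) by auto
    qed
    then have "c q \<noteq> 0" "d q \<noteq> 0"
      using cd pq by blast+
    with cd(3) pq(3) show False
      by (auto simp: mult_eq_ideal_function_ring_zero_iff)
  qed
  then show "e \<in> parcs (zero_divisor_graph ?R)"
    using e V by (simp add: zero_divisor_graph_def)
qed

text \<open>
  Three local points carry functions \<open>f\<close>, \<open>g\<close>, \<open>h\<close> with disjoint supports. The second vertex
  \<open>f + f\<close> is merely a vertex different from \<open>f\<close> with the same annihilator.
\<close>

lemma weakly_zero_divisor_graph_neq_zero_divisor_graph:
  assumes cr: "completely_regular_space X" and H: "Hausdorff_space X"
    and P: "ideal_of_closed_sets X P"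
    and L: "{x, y, z} \<subseteq> local_points X P" and ne: "x \<noteq> y" "x \<noteq> z" "y \<noteq> z"
  shows "zero_divisor_graph (ideal_function_ring X P) \<noteq>
           weakly_zero_divisor_graph (ideal_function_ring X P)"
proof -
  let ?R = "ideal_function_ring X P"
  have top: "{x, y, z} \<subseteq> topspace X"
    using L by (auto simp: local_points_def)
  obtain U V W where op: "openin X U" "openin X V" "openin X W"
      and mem: "x \<in> U" "y \<in> V" "z \<in> W"
      and disj: "U \<inter> V = {}" "U \<inter> W = {}" "V \<inter> W = {}"
    using Hausdorff_space_separate_three[OF H top ne] by metis
  obtain f where f: "f \<in> carrier ?R" "f x \<noteq> 0" "\<And>t. t \<in> topspace X - U \<Longrightarrow> f t = 0"
    using ideal_function_ring_bump[OF cr P _ op(1) mem(1)] L by auto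
  obtain g where g: "g \<in> carrier ?R" "g y \<noteq> 0" "\<And>t. t \<in> topspace X - V \<Longrightarrow> g t = 0"
    using ideal_function_ring_bump[OF cr P _ op(2) mem(2)] L by auto
  obtain h where h: "h \<in> carrier ?R" "h z \<noteq> 0" "\<And>t. t \<in> topspace X - W \<Longrightarrow> h t = 0"
    using ideal_function_ring_bump[OF cr P _ op(3) mem(3)] L by auto
  define k where "k = f \<oplus>\<^bsub>?R\<^esub> f"
  have k: "k \<in> carrier ?R" "\<And>t. t \<in> topspace X \<Longrightarrow> k t = f t + f t"
    using ideal_function_ring_add_closed[OF P f(1) f(1)]
    by (simp_all add: k_def ideal_function_ring_add)
  have fg: "f t = 0 \<or> g t = 0" and fh: "f t = 0 \<or> h t = 0" and gh: "g t = 0 \<or> h t = 0"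
    if "t \<in> topspace X" for t
    using that f(3)[of t] g(3)[of t] h(3)[of t] disj by blast+
  have "x \<in> topspace X" "y \<in> topspace X" "k x \<noteq> 0" "\<forall>t\<in>topspace X. k t = 0 \<or> g t = 0"
    using f(2) k(2) fg top by auto
  then have vertices: "f \<in> nonzero_zero_divisors ?R" "k \<in> nonzero_zero_divisors ?R"
    unfolding nonzero_zero_divisor_ideal_function_ring_iff
    using f(1,2) k(1) g(1,2) fg by blast+
  have "f \<noteq> k"
    using k(2)[of x] f(2) top by auto
  moreover have "g \<in> ann ?R f - {\<zero>\<^bsub>?R\<^esub>}" "h \<in> ann ?R k - {\<zero>\<^bsub>?R\<^esub>}"
    using g h fg fh k(2) top
    by (auto simp: mem_ann_ideal_function_ring_iff eq_ideal_function_ring_zero_iff)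
  moreover have "g \<otimes>\<^bsub>?R\<^esub> h = \<zero>\<^bsub>?R\<^esub>"
    using gh by (simp add: mult_eq_ideal_function_ring_zero_iff)
  ultimately have "(f, k) \<in> parcs (weakly_zero_divisor_graph ?R)"
    using vertices unfolding weakly_zero_divisor_graph_def by auto
  moreover have "f \<otimes>\<^bsub>?R\<^esub> k \<noteq> \<zero>\<^bsub>?R\<^esub>"
    using f(2) k(2) top by (auto simp: mult_eq_ideal_function_ring_zero_iff)
  then have "(f, k) \<notin> parcs (zero_divisor_graph ?R)"
    by (simp add: zero_divisor_graph_def)
  ultimately show ?thesis
    by metis
qed

lemma obtain_three_distinct:
  assumes "\<not> (finite S \<and> card S \<le> 2)"
  obtains x y z where "{x, y, z} \<subseteq> S" "x \<noteq> y" "x \<noteq> z" "y \<noteq> z"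
proof -
  have "\<exists>T. T \<subseteq> S \<and> card T = 3"
  proof (cases "finite S")
    case True
    then have "3 \<le> card S"
      using assms by simp
    then show ?thesis
      by (meson obtain_subset_with_card_n)
  next
    case False
    then show ?thesis
      by (meson infinite_arbitrarily_large)
  qed
  then obtain x y z where "{x, y, z} \<subseteq> S" "x \<noteq> y" "x \<noteq> z" "y \<noteq> z"
    unfolding card_3_iff by metis
  then show thesis
    by (rule that)
qed

theorem theorem3p5:
  fixes X :: "'a topology" and P :: "'a set set"
  assumes "completely_regular_space X" and "Hausdorff_space X"
    and "ideal_of_closed_sets X P"
  shows "(zero_divisor_graph (ideal_function_ring X P) =
            annihilator_graph (ideal_function_ring X P) \<and>
          annihilator_graph (ideal_function_ring X P) =
            weakly_zero_divisor_graph (ideal_function_ring X P)) \<longleftrightarrow>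
         finite (local_points X P) \<and> card (local_points X P) \<le> 2"
    (is "?eq \<longleftrightarrow> ?two")
proof
  assume eq: ?eq
  show ?two
  proof (rule ccontr)
    assume "\<not> ?two"
    then obtain x y z where "{x, y, z} \<subseteq> local_points X P" "x \<noteq> y" "x \<noteq> z" "y \<noteq> z"
      by (rule obtain_three_distinct)
    from weakly_zero_divisor_graph_neq_zero_divisor_graph[OF assms this] eq show False
      by simp
  qed
next
  let ?R = "ideal_function_ring X P"
  assume ?two
  then have "parcs (zero_divisor_graph ?R) = parcs (annihilator_graph ?R)"
    and "parcs (zero_divisor_graph ?R) = parcs (weakly_zero_divisor_graph ?R)"
    using zero_divisor_graph_subset_annihilator_graph[OF assms(3)]
      annihilator_graph_subset_zero_divisor_graph
      zero_divisor_graph_subset_weakly_zero_divisor_graph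
      weakly_zero_divisor_graph_subset_zero_divisor_graph
    by (metis subset_antisym)+
  moreover have "pverts (zero_divisor_graph ?R) = pverts (annihilator_graph ?R)"
    and "pverts (zero_divisor_graph ?R) = pverts (weakly_zero_divisor_graph ?R)"
    by (simp_all add: zero_divisor_graph_def annihilator_graph_def weakly_zero_divisor_graph_def)
  ultimately show ?eq
    by simp
qed

end
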